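(* (a) For every prime $p\ge 11$, all of the following hold modulo $p$: $$2\sum_{j=1}^{p-1}\frac{H_j^{(2)}H_j}{j^3}\equiv -3\sum_{j=1}^{p-1}\frac{H_j^{(3)}H_j}{j^2}\equiv -6\sum_{j=1}^{p-1}\frac{H_j^{(3)}H_j^{(2)}}{j}\equiv -3\sum_{j=1}^{p-1}\frac{(H_j)^2}{j^4}\equiv 6\sum_{j=1}^{p-1}\frac{H_j^{(4)}H_j}{j}\equiv B_{p-3}^2\pmod p,$$ and $$\sum_{j=1}^{p-1}\frac{H_jH_j^{(2)}}{j^{2}}\equiv -\frac12 B_{p-5}\pmod p.$$ (b) For every prime $p\ge 17$, $$\sum_{j=1}^{p-1}\frac{H_j^{(5)}H_j^{(4)}}{j^{3}}\equiv 0\pmod p.$$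
   Context: For positive integers $s$ and $n\ge 0$, $H_n^{(s)}=\sum_{k=1}^{n}\frac{1}{k^s}$, and $H_n=H_n^{(1)}$. $(B_n)_{n\ge 0}$ is the sequence of Bernoulli numbers. Congruences modulo $p$ are between rational numbers whose denominators are prime to $p$. *)

theory Defs
  imports Complex_Main "HOL-Computational_Algebra.Primes"
begin

text \<open>\<open>harmonic s n\<close> is \<open>H\<^sub>n\<^sup>(\<^sup>s\<^sup>)\<close>.\<close>

definition harmonic :: "nat \<Rightarrow> nat \<Rightarrow> rat" where
  "harmonic s n = (\<Sum>k = 1..n. 1 / of_nat k ^ s)"

text \<open>
  The second equation is \<open>\<Sum>k\<le>m. (m + 1 choose k) * B\<^sub>k = 0\<close> solved for \<open>B\<^sub>m\<close>, where
  \<open>m = Suc n\<close>; this is the convention \<open>B\<^sub>1 = - 1/2\<close>.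
\<close>

fun bernoulli :: "nat \<Rightarrow> rat" where
  "bernoulli 0 = 1"
| "bernoulli (Suc n) =
     - (\<Sum>k\<le>n. of_nat (n + 2 choose k) * bernoulli k) / of_nat (n + 2)"

text \<open>
  Congruence modulo \<open>m\<close> between rationals whose denominators are prime to \<open>m\<close>. The condition
  on both denominators is part of the relation, so a congruence asserts it. The function
  \<^const>\<open>quotient_of\<close> returns the reduced fraction with positive denominator. The generic
  congruence of \<open>HOL-Number_Theory.Cong\<close> does not serve here: at type \<^typ>\<open>rat\<close>
  it would be congruence in a field.
\<close>

definition rat_cong :: "rat \<Rightarrow> rat \<Rightarrow> nat \<Rightarrow> bool"
    (\<open>(\<open>indent=1 notation=\<open>mixfix rat_cong\<close>\<close>[_ \<equiv> _] '(' rmod _'))\<close>) where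
  "[x \<equiv> y] (rmod m) \<longleftrightarrow>
     coprime (snd (quotient_of x)) (int m) \<and>
     coprime (snd (quotient_of y)) (int m) \<and>
     int m dvd fst (quotient_of (x - y))"

end

theory Submission
  imports Defs "HOL-Computational_Algebra.Formal_Power_Series" "HOL-Number_Theory.Residues"
begin

text \<open>
  Write \<open>f(a, b | c)\<close> for the sum of \<open>H\<^sub>j\<^sup>(\<^sup>a\<^sup>) H\<^sub>j\<^sup>(\<^sup>b\<^sup>) / j\<^sup>c\<close> over \<open>0 < j < p\<close>, and
  \<open>w = a + b + c\<close> for its weight. All congruences are modulo the prime \<open>p\<close>. Three facts
  suffice.

  First, symmetry. Since \<open>j \<mapsto> p - j\<close> turns \<open>H\<^sub>j\<^sup>(\<^sup>s\<^sup>)\<close> into a multiple \<open>\<plusminus>1\<close> of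
  \<open>H\<^sup>(\<^sup>s\<^sup>)\<close> at \<open>j - 1\<close>, the sum \<open>f(a, b | c)\<close> agrees up to the sign \<open>(-1)\<^sup>w\<close> with the sum
  of the same shape whose inner sums stop before \<open>j\<close> (\<open>triple_sum_reflect\<close>). Comparing the
  two directly gives the sums of odd weight in terms of double sums; this is the
  congruence of weight 5. For even weight, telescoping a product of three harmonic numbers
  gives instead \<open>f(a, b | c) + f(a, c | b) + f(b, c | a) \<equiv> 0\<close> (\<open>triple_sum_cyclic\<close>).

  Second, Bernoulli numbers. Replace \<open>1/k\<^sup>s\<close> by \<open>k\<^bsup>p-1-s\<^esup>\<close> and apply Faulhaber's formula: a
  harmonic number is modulo \<open>p\<close> a polynomial in \<open>j\<close> with Bernoulli numbers as coefficients
  (\<open>harmonic_zcong_bernoulli\<close>). As the power sums over \<open>0 < j < p\<close> vanish except for exponents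
  divisible by \<open>p - 1\<close>, the sum \<open>a b f(a, b | c)\<close> becomes, up to sign, a weighted convolution
  of the \<open>B\<^sub>i B\<^sub>k\<close> with \<open>i + k = p + 1 - w\<close>, plus a short tail of products with
  \<open>i + k = 2 p - w\<close> (\<open>strict_triple_sum_zcong\<close>). The tail is the origin of
  \<open>B\<^bsub>p-3\<^esub>\<^sup>2\<close>.

  Third, the weights are binomial coefficients, and Euler's identity for a bihomogeneous
  function relates the convolutions to each other (\<open>bernoulli_conv_euler\<close>). On the diagonal
  it makes the convolution for \<open>(a + 1, a)\<close> a multiple of the one for \<open>(a, a)\<close>.

  In weight 6 let \<open>T\<close> and \<open>V\<close> be the convolutions for \<open>(1, 1)\<close> and \<open>(2, 2)\<close>, and
  \<open>X = B\<^bsub>p-3\<^esub>\<^sup>2\<close>. All sums are combinations of \<open>T\<close>, \<open>V\<close>, \<open>X\<close>, while \<open>3 f(2, 2 | 2) \<equiv> 0\<close>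
  gives \<open>V \<equiv> - 4 X\<close> and \<open>f(2, 1 | 3) + f(3, 1 | 2) + f(3, 2 | 1) \<equiv> 0\<close> gives \<open>3 T \<equiv> - 2 X\<close>.
  In weight 12 the diagonal relation says \<open>10 f(5, 4 | 3) + 3 f(4, 4 | 4) \<equiv> 0\<close>, tails included,
  and \<open>f(4, 4 | 4)\<close> vanishes because \<open>3 f(4, 4 | 4)\<close> does.
\<close>

section \<open>Bernoulli numbers\<close>

lemma bernoulli_recurrence:
  "(\<Sum>k\<le>m. of_nat (Suc m choose k) * bernoulli k) = (if m = 0 then 1 else 0)"
proof (cases m)
  case (Suc n)
  have "bernoulli (Suc n) * of_nat (n + 2)
      = - (\<Sum>k\<le>n. of_nat (n + 2 choose k) * bernoulli k)"
    by (simp add: field_simps del: of_nat_add of_nat_Suc)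
  moreover have "n + 2 choose Suc n = n + 2"
    using binomial_symmetric[of "Suc n" "n + 2"] by simp
  ultimately show ?thesis using Suc by (simp add: mult.commute)
qed simp

definition bernoulli_egf :: "rat fps" where
  "bernoulli_egf = Abs_fps (\<lambda>n. bernoulli n / fact n)"

lemma bernoulli_egf_mult_exp: "bernoulli_egf * (fps_exp 1 - 1) = fps_X"
proof (rule fps_ext)
  fix n
  show "fps_nth (bernoulli_egf * (fps_exp 1 - 1)) n = fps_nth fps_X n"
  proof (cases n)
    case (Suc m)
    have "fps_nth (bernoulli_egf * (fps_exp 1 - 1)) n
        = (\<Sum>k\<le>Suc m. bernoulli k / fact k * (if k = Suc m then 0 else 1 / fact (Suc m - k)))"
      unfolding fps_mult_nth Suc bernoulli_egf_def atLeast0AtMost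
      by (intro sum.cong refl) auto
    also have "\<dots> = (\<Sum>k\<le>m. bernoulli k / fact k * (1 / fact (Suc m - k)))"
      by (auto intro!: sum.cong)
    also have "\<dots> = (\<Sum>k\<le>m. of_nat (Suc m choose k) * bernoulli k) / fact (Suc m)"
      unfolding sum_divide_distrib
      by (intro sum.cong refl) (simp add: binomial_fact del: fact_Suc binomial_Suc_Suc)
    also have "\<dots> = fps_nth fps_X n"
      using Suc by (simp add: bernoulli_recurrence del: fact_Suc binomial_Suc_Suc)
    finally show ?thesis .
  qed simp
qed

lemma fps_exp_1_minus_1_nonzero: "fps_exp (1::rat) - 1 \<noteq> 0"
proof
  assume "fps_exp (1::rat) - 1 = 0"
  then have "fps_nth (fps_exp (1::rat) - 1) 1 = 0" by simp
  then show False by simp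
qed

text \<open>
  With \<open>B\<close> the exponential generating function of the Bernoulli numbers, the geometric sum
  \<open>S = \<Sum>k<n. exp(k X)\<close> satisfies \<open>S (exp X - 1) = exp(n X) - 1\<close>. As
  \<open>B (exp X - 1) = X\<close>, cancelling \<open>exp X - 1\<close> leaves \<open>X S = B (exp(n X) - 1)\<close>; the identity
  compares coefficients of \<open>X\<^bsup>m+1\<^esup>\<close>. The convention \<open>B\<^sub>1 = - 1/2\<close> is what makes the sum
  stop at \<open>n - 1\<close>.
\<close>

lemma faulhaber:
  "of_nat (Suc m) * (\<Sum>k<n. of_nat k ^ m)
    = (\<Sum>i\<le>m. of_nat (Suc m choose i) * bernoulli i * of_nat n ^ (Suc m - i))"
proof -
  define S :: "rat fps" where "S = (\<Sum>k<n. fps_exp (of_nat k))"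
  have exp_pow: "fps_exp (of_nat k) = fps_exp (1::rat) ^ k" for k
    by (simp add: fps_exp_power_mult)
  have "S * (fps_exp 1 - 1) = fps_exp (of_nat n) - 1"
    unfolding S_def exp_pow using power_diff_1_eq[of "fps_exp (1::rat)" n] by (simp add: mult.commute)
  then have "fps_X * S * (fps_exp 1 - 1)
      = bernoulli_egf * (fps_exp (of_nat n) - 1) * (fps_exp 1 - 1)"
    using bernoulli_egf_mult_exp by (metis (no_types, lifting) mult.assoc mult.commute)
  then have eq: "fps_X * S = bernoulli_egf * (fps_exp (of_nat n) - 1)"
    using fps_exp_1_minus_1_nonzero by (metis mult_right_cancel)
  have "fps_nth (fps_X * S) (Suc m) = (\<Sum>k<n. of_nat k ^ m) / fact m"
    by (simp add: S_def fps_sum_nth sum_divide_distrib)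
  moreover have "fps_nth (bernoulli_egf * (fps_exp (of_nat n) - 1)) (Suc m)
     = (\<Sum>i\<le>m. of_nat (Suc m choose i) * bernoulli i * of_nat n ^ (Suc m - i)) / fact (Suc m)"
  proof -
    have "fps_nth (bernoulli_egf * (fps_exp (of_nat n) - 1)) (Suc m)
      = (\<Sum>k\<le>Suc m. bernoulli k / fact k *
          (if k = Suc m then 0 else of_nat n ^ (Suc m - k) / fact (Suc m - k)))"
      unfolding fps_mult_nth bernoulli_egf_def atLeast0AtMost
      by (intro sum.cong refl) auto
    also have "\<dots> = (\<Sum>k\<le>m. bernoulli k / fact k * (of_nat n ^ (Suc m - k) / fact (Suc m - k)))"
      by (auto intro!: sum.cong)
    also have "\<dots> = (\<Sum>i\<le>m. of_nat (Suc m choose i) * bernoulli i * of_nat n ^ (Suc m - i))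
        / fact (Suc m)"
      unfolding sum_divide_distrib
      by (intro sum.cong refl) (simp add: binomial_fact del: fact_Suc binomial_Suc_Suc)
    finally show ?thesis .
  qed
  ultimately have "(\<Sum>k<n. of_nat k ^ m) / fact m
     = (\<Sum>i\<le>m. of_nat (Suc m choose i) * bernoulli i * of_nat n ^ (Suc m - i)) / fact (Suc m)"
    using eq by simp
  moreover have "(fact (Suc m) :: rat) = of_nat (Suc m) * fact m" by simp
  ultimately show ?thesis
    by (simp add: field_simps del: of_nat_Suc fact_Suc binomial_Suc_Suc)
qed

text \<open>
  Substituting \<open>- X\<close> for \<open>X\<close> in \<open>B (exp X - 1) = X\<close> gives \<open>B(- X) = B(X) + X\<close>, so the odd
  coefficients of \<open>B\<close> other than the first are equal to their negatives.
\<close>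

lemma bernoulli_odd:
  assumes "odd n" "n \<noteq> 1"
  shows "bernoulli n = 0"
proof -
  let ?E = "fps_exp (1::rat)"
  define R :: "rat fps" where "R = fps_compose bernoulli_egf (- fps_X)"
  have "fps_compose (bernoulli_egf * (?E - 1)) (- fps_X) = - fps_X"
    unfolding bernoulli_egf_mult_exp by simp
  then have R1: "R * (fps_exp (-1) - 1) = - fps_X"
    by (simp add: R_def fps_compose_mult_distrib fps_compose_sub_distrib
        fps_exp_compose_linear[of 1 "-1", simplified])
  have inv: "fps_exp (-1) * ?E = 1"
    using fps_exp_add_mult[of "-1::rat" 1] by simp
  have "R * (?E - 1) = - (R * (fps_exp (-1) - 1)) * ?E"
    using inv by (simp add: algebra_simps)
  also have "\<dots> = fps_X * (?E - 1) + fps_X"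
    unfolding R1 by (simp add: algebra_simps)
  also have "\<dots> = (fps_X + bernoulli_egf) * (?E - 1)"
    using bernoulli_egf_mult_exp by (simp add: algebra_simps)
  finally have "R = fps_X + bernoulli_egf"
    using fps_exp_1_minus_1_nonzero by (metis mult_right_cancel)
  then have "fps_nth R n = fps_nth bernoulli_egf n" using assms by simp
  moreover have "fps_nth R n = - fps_nth bernoulli_egf n"
    unfolding R_def using assms by (simp add: fps_compose_uminus')
  ultimately show ?thesis by (simp add: bernoulli_egf_def)
qed

section \<open>Convolutions of Bernoulli numbers\<close>

text \<open>
  Up to the sign \<open>(-1)\<^sup>i\<close> this is the binomial coefficient with upper index \<open>- a\<close> and lower
  index \<open>i\<close>, for \<open>0 < a\<close>. As a function of \<open>i\<close> it is a polynomial of degree \<open>a - 1\<close>.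
\<close>

definition negbinom :: "nat \<Rightarrow> nat \<Rightarrow> rat" where
  "negbinom a i = of_nat (a + i - 1 choose i)"

definition bernoulli_conv :: "nat \<Rightarrow> nat \<Rightarrow> nat \<Rightarrow> rat" where
  "bernoulli_conv a b n
    = (\<Sum>i\<le>n. negbinom a i * bernoulli i * (negbinom b (n - i) * bernoulli (n - i)))"

lemma negbinom_Suc:
  assumes "0 < a"
  shows "of_nat a * negbinom (a + 1) i = of_nat (a + i) * negbinom a i"
proof -
  have "a * (a + i choose i) = (a + i) * (a + i - 1 choose i)"
    using binomial_absorb_comp[of "a + i" i] by simp
  then show ?thesis
    unfolding negbinom_def by (simp flip: of_nat_mult of_nat_add)
qed

lemma bernoulli_conv_commute: "bernoulli_conv a b n = bernoulli_conv b a n"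
  unfolding bernoulli_conv_def
  by (intro sum.reindex_bij_witness[of _ "\<lambda>i. n - i" "\<lambda>i. n - i"]) auto

text \<open>
  The operators \<open>a + i\<close> and \<open>b + k\<close> raise the two weights by one step each
  (\<open>negbinom_Suc\<close>), and their sum \<open>a + b + i + k = a + b + n\<close> is constant along the
  convolution.
\<close>

lemma bernoulli_conv_euler:
  assumes "0 < a" "0 < b"
  shows "of_nat a * bernoulli_conv (a + 1) b n + of_nat b * bernoulli_conv a (b + 1) n
    = of_nat (a + b + n) * bernoulli_conv a b n"
  unfolding bernoulli_conv_def sum_distrib_left sum.distrib[symmetric]
proof (rule sum.cong[OF refl])
  fix i assume "i \<in> {..n}"
  let ?u = "bernoulli i * bernoulli (n - i)"
  have "of_nat a * (negbinom (a + 1) i * bernoulli i * (negbinom b (n - i) * bernoulli (n - i)))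
      + of_nat b * (negbinom a i * bernoulli i * (negbinom (b + 1) (n - i) * bernoulli (n - i)))
      = (of_nat a * negbinom (a + 1) i) * negbinom b (n - i) * ?u
      + (of_nat b * negbinom (b + 1) (n - i)) * negbinom a i * ?u"
    by (simp only: mult_ac)
  also have "\<dots> = of_nat ((a + i) + (b + (n - i))) * (negbinom a i * negbinom b (n - i) * ?u)"
    unfolding negbinom_Suc[OF assms(1)] negbinom_Suc[OF assms(2)] of_nat_add[of "a + i"]
    by (simp only: distrib_right distrib_left mult_ac)
  also have "(a + i) + (b + (n - i)) = a + b + n" using \<open>i \<in> {..n}\<close> by simp
  finally show "of_nat a * (negbinom (a + 1) i * bernoulli i * (negbinom b (n - i) * bernoulli (n - i)))
      + of_nat b * (negbinom a i * bernoulli i * (negbinom (b + 1) (n - i) * bernoulli (n - i)))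
      = of_nat (a + b + n) * (negbinom a i * bernoulli i * (negbinom b (n - i) * bernoulli (n - i)))"
    by (simp only: mult_ac)
qed

lemma bernoulli_conv_diagonal:
  assumes "0 < a"
  shows "of_nat (2 * a) * bernoulli_conv (a + 1) a n = of_nat (2 * a + n) * bernoulli_conv a a n"
  using bernoulli_conv_euler[OF assms assms, of n]
  unfolding bernoulli_conv_commute[of a "a + 1"] mult_2 of_nat_add distrib_right
  by simp

section \<open>Harmonic numbers\<close>

lemma harmonic_0 [simp]: "harmonic s 0 = 0"
  by (simp add: harmonic_def)

lemma harmonic_step: "0 < j \<Longrightarrow> harmonic s j = harmonic s (j - 1) + 1 / of_nat j ^ s"
  by (cases j) (simp_all add: harmonic_def)

section \<open>Arithmetic of p-integral rationals modulo a prime\<close>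

text \<open>
  Congruence modulo \<open>p\<close> is handled as membership of a difference in the ideal generated by
  \<open>p\<close> in the ring of rationals with denominator prime to \<open>p\<close>. Neither side is required to
  be integral, which keeps sums and linear combinations free of side conditions; integrality
  matters only for products and for the passage to \<open>rat_cong\<close>.
\<close>

locale odd_prime =
  fixes p :: nat
  assumes prime_p: "prime p" and p_gt_2: "2 < p"
begin

definition p_integral :: "rat set" where
  "p_integral = {x. \<not> int p dvd snd (quotient_of x)}"

lemma int_prime_p: "prime (int p)"
  using prime_p by simp

lemma p_integralI:
  assumes "x = of_int a / of_int b" "\<not> int p dvd b"
  shows "x \<in> p_integral"
proof -
  obtain c d where q: "quotient_of x = (c, d)" by force
  then have x: "x = of_int c / of_int d" and "d > 0" and "coprime c d"
    using quotient_of_div quotient_of_denom_pos quotient_of_coprime by auto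
  have "b \<noteq> 0" using assms(2) by auto
  with x assms(1) \<open>d > 0\<close> have "of_int (c * b) = (of_int (a * d) :: rat)"
    by (simp add: field_simps)
  then have "c * b = a * d" unfolding of_int_eq_iff .
  have "\<not> int p dvd d"
  proof
    assume d: "int p dvd d"
    then have "int p dvd c * b" using \<open>c * b = a * d\<close> by simp
    then have "int p dvd c" using int_prime_p assms(2) prime_dvd_mult_iff by blast
    with d \<open>coprime c d\<close> \<open>int p dvd c\<close> have "is_unit (int p)"
      using coprime_common_divisor[of c d "int p"] by simp
    then show False using p_gt_2 by simp
  qed
  then show ?thesis by (simp add: p_integral_def q)
qed

lemma p_integralE:
  assumes "x \<in> p_integral"
  obtains a b where "x = of_int a / of_int b" "\<not> int p dvd b" "b \<noteq> 0"
proof -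
  obtain c d where q: "quotient_of x = (c, d)" by force
  with assms have "\<not> int p dvd d" by (simp add: p_integral_def)
  moreover from this have "d \<noteq> 0" by auto
  ultimately show ?thesis using that quotient_of_div[OF q] by blast
qed

lemma p_integral_of_int [simp, intro]: "of_int a \<in> p_integral"
  by (rule p_integralI[of _ a 1]) (use p_gt_2 in auto)

lemma p_integral_of_nat [simp, intro]: "of_nat a \<in> p_integral"
  using p_integral_of_int[of "int a"] by simp

lemma p_integral_numeral [simp, intro]: "0 \<in> p_integral" "1 \<in> p_integral" "numeral k \<in> p_integral"
  using p_integral_of_nat[of 0] p_integral_of_nat[of 1] p_integral_of_nat[of "numeral k"] by simp_all

lemma p_integral_fact [simp, intro]: "fact a \<in> p_integral"
  using p_integral_of_nat[of "fact a"] by simp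

lemma p_integral_inverse:
  assumes "\<not> p dvd k"
  shows "1 / of_nat k \<in> p_integral"
  by (rule p_integralI[of _ 1 "int k"]) (use assms in auto)

lemma not_p_dvd_less: "0 < k \<Longrightarrow> k < p \<Longrightarrow> \<not> p dvd k"
  by (auto dest: dvd_imp_le)

lemma p_integral_mult [simp, intro]:
  assumes "x \<in> p_integral" "y \<in> p_integral"
  shows "x * y \<in> p_integral"
proof -
  from assms obtain a b c d where "x = of_int a / of_int b" "\<not> int p dvd b"
    "y = of_int c / of_int d" "\<not> int p dvd d"
    by (elim p_integralE)
  then show ?thesis
    using int_prime_p
    by (intro p_integralI[of _ "a * c" "b * d"]) (auto simp: prime_dvd_mult_iff)
qed

lemma p_integral_add [simp, intro]:
  assumes "x \<in> p_integral" "y \<in> p_integral"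
  shows "x + y \<in> p_integral"
proof -
  from assms obtain a b c d where "x = of_int a / of_int b" "\<not> int p dvd b" "b \<noteq> 0"
    "y = of_int c / of_int d" "\<not> int p dvd d" "d \<noteq> 0"
    by (elim p_integralE)
  then show ?thesis
    using int_prime_p
    by (intro p_integralI[of _ "a * d + c * b" "b * d"])
       (auto simp: prime_dvd_mult_iff field_simps)
qed

lemma p_integral_uminus [simp, intro]: "x \<in> p_integral \<Longrightarrow> - x \<in> p_integral"
  using p_integral_mult[of "of_int (- 1)" x] p_integral_of_int[of "- 1"] by simp

lemma p_integral_diff [simp, intro]:
  "x \<in> p_integral \<Longrightarrow> y \<in> p_integral \<Longrightarrow> x - y \<in> p_integral"
  using p_integral_add[of x "- y"] by auto

lemma p_integral_power [simp, intro]: "x \<in> p_integral \<Longrightarrow> x ^ n \<in> p_integral"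
  by (induction n) auto

lemma p_integral_sum [intro]: "(\<And>i. i \<in> A \<Longrightarrow> f i \<in> p_integral) \<Longrightarrow> sum f A \<in> p_integral"
  by (induction A rule: infinite_finite_induct) auto

lemma p_integral_divide_power:
  assumes "x \<in> p_integral" "0 < k" "k < p"
  shows "x / of_nat k ^ n \<in> p_integral"
proof -
  have "x * (1 / of_nat k) ^ n \<in> p_integral"
    using assms by (intro p_integral_mult p_integral_power p_integral_inverse not_p_dvd_less)
  then show ?thesis by (simp add: power_one_over)
qed

lemma p_integral_harmonic [intro]: "j < p \<Longrightarrow> harmonic s j \<in> p_integral"
  unfolding harmonic_def by (intro p_integral_sum p_integral_divide_power) auto

text \<open>
  The recurrence for \<open>B\<^sub>i\<close> divides by nothing larger than \<open>i + 1\<close>, so \<open>p\<close> cannot enter a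
  denominator before \<open>i = p - 1\<close>.
\<close>

lemma p_integral_bernoulli [intro]: "i + 2 \<le> p \<Longrightarrow> bernoulli i \<in> p_integral"
proof (induction i rule: less_induct)
  case (less i)
  show ?case
  proof (cases i)
    case (Suc n)
    have "- (\<Sum>k\<le>n. of_nat (n + 2 choose k) * bernoulli k) * (1 / of_nat (n + 2)) \<in> p_integral"
      using less Suc
      by (intro p_integral_mult p_integral_uminus p_integral_sum p_integral_inverse not_p_dvd_less) auto
    then show ?thesis using Suc by simp
  qed auto
qed

definition zcong :: "rat \<Rightarrow> rat \<Rightarrow> bool" (infix \<open>\<approx>\<close> 50) where
  "x \<approx> y \<longleftrightarrow> (\<exists>u\<in>p_integral. x - y = of_nat p * u)"

lemma zcongI: "x - y = of_nat p * u \<Longrightarrow> u \<in> p_integral \<Longrightarrow> x \<approx> y"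
  by (auto simp: zcong_def)

lemma zcong_refl [simp, intro]: "x \<approx> x"
  by (rule zcongI[of _ _ 0]) auto

lemma zcong_sym: "x \<approx> y \<Longrightarrow> y \<approx> x"
  unfolding zcong_def by (metis minus_diff_eq mult_minus_right p_integral_uminus)

lemma zcong_add: assumes "x \<approx> y" "x' \<approx> y'" shows "x + x' \<approx> y + y'"
proof -
  from assms obtain u v where "u \<in> p_integral" "x - y = of_nat p * u"
    "v \<in> p_integral" "x' - y' = of_nat p * v" by (auto simp: zcong_def)
  then show ?thesis by (intro zcongI[of _ _ "u + v"]) (auto simp: algebra_simps)
qed

lemma zcong_trans [trans]: assumes "x \<approx> y" "y \<approx> z" shows "x \<approx> z"
  using zcong_add[OF assms] by (simp add: zcong_def algebra_simps)

text \<open>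
  These two instances of substitution keep calculations away from the general substitution
  rules, whose higher-order unification explodes on large sums.
\<close>

lemma zcong_eq_trans [trans]: "x \<approx> y \<Longrightarrow> y = z \<Longrightarrow> x \<approx> z"
  by simp

lemma eq_zcong_trans [trans]: "x = y \<Longrightarrow> y \<approx> z \<Longrightarrow> x \<approx> z"
  by simp

lemma zcong_scale: assumes "c \<in> p_integral" "x \<approx> y" shows "c * x \<approx> c * y"
proof -
  from assms obtain u where "u \<in> p_integral" "x - y = of_nat p * u"
    by (auto simp: zcong_def)
  then show ?thesis using assms(1)
    by (intro zcongI[of _ _ "c * u"]) (auto simp flip: right_diff_distrib)
qed

lemma zcong_uminus: "x \<approx> y \<Longrightarrow> - x \<approx> - y"
  using zcong_scale[of "- 1" x y] by simp

lemma zcong_diff: "x \<approx> y \<Longrightarrow> x' \<approx> y' \<Longrightarrow> x - x' \<approx> y - y'"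
  using zcong_add[of x y "- x'" "- y'"] zcong_uminus by simp

lemma zcong_sum: "(\<And>i. i \<in> A \<Longrightarrow> f i \<approx> g i) \<Longrightarrow> sum f A \<approx> sum g A"
  by (induction A rule: infinite_finite_induct) (auto intro: zcong_add)

lemma zcong_mult:
  assumes "x \<approx> y" "x' \<approx> y'" "x' \<in> p_integral" "y \<in> p_integral"
  shows "x * x' \<approx> y * y'"
  using zcong_trans[OF zcong_scale[OF assms(3,1)]] zcong_scale[OF assms(4,2)]
  by (simp add: mult.commute)

lemma zcong_cancel:
  assumes "of_nat k * x \<approx> of_nat k * y" "\<not> p dvd k"
  shows "x \<approx> y"
proof -
  have "0 < k" using assms(2) by (cases k) auto
  then show ?thesis
    using zcong_scale[OF p_integral_inverse[OF assms(2)] assms(1)] by simp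
qed

lemma zcong_of_int: "[a = b] (mod int p) \<Longrightarrow> of_int a \<approx> of_int b"
proof -
  assume "[a = b] (mod int p)"
  then obtain k where "a - b = int p * k" by (auto simp: cong_iff_dvd_diff)
  then have "of_int a - of_int b = (of_nat p * of_int k :: rat)"
    by (metis of_int_diff of_int_mult of_int_of_nat_eq)
  then show ?thesis by (rule zcongI) auto
qed

lemma zcong_of_nat: "[a = b] (mod p) \<Longrightarrow> of_nat a \<approx> of_nat b"
  using zcong_of_int[of "int a" "int b"] by (simp add: cong_int_iff)

lemma zcong_p_minus: "k \<le> p \<Longrightarrow> of_nat (p - k) \<approx> - of_nat k"
  by (rule zcongI[of _ _ 1]) (auto simp: of_nat_diff)

lemma zcong_power: "x \<approx> y \<Longrightarrow> x \<in> p_integral \<Longrightarrow> y \<in> p_integral \<Longrightarrow> x ^ n \<approx> y ^ n"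
  by (induction n) (auto intro!: zcong_mult)

lemma zcong_rearrange: "x \<approx> y \<Longrightarrow> x - y = z - w \<Longrightarrow> z \<approx> w"
  by (simp add: zcong_def)

text \<open>
  The form in which linear algebra modulo \<open>p\<close> is carried out: given two congruences and the
  coefficients of a linear combination, only an identity of rationals remains.
\<close>

lemma zcong_combine:
  assumes "x \<approx> y" "x' \<approx> y'" "c \<in> p_integral" "c' \<in> p_integral"
    and "z - w = c * (x - y) + c' * (x' - y')"
  shows "z \<approx> w"
  by (rule zcong_rearrange[OF zcong_add[OF zcong_scale[OF assms(3,1)] zcong_scale[OF assms(4,2)]]])
     (simp add: assms(5) algebra_simps)

lemma zcong_p_minus_mult: "k \<le> p \<Longrightarrow> x \<in> p_integral \<Longrightarrow> of_nat (p - k) * x \<approx> - of_nat k * x"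
  by (intro zcong_mult zcong_p_minus) auto

lemma zcong_imp_rat_cong:
  assumes "x \<approx> y" "x \<in> p_integral" "y \<in> p_integral"
  shows "[x \<equiv> y] (rmod p)"
proof -
  have cop: "coprime (snd (quotient_of z)) (int p)" if "z \<in> p_integral" for z
  proof -
    have "\<not> int p dvd snd (quotient_of z)" using that by (simp add: p_integral_def)
    then have "coprime (int p) (snd (quotient_of z))" by (rule prime_imp_coprime[OF int_prime_p])
    then show ?thesis by (rule coprime_commute[THEN iffD1])
  qed
  obtain u where u: "u \<in> p_integral" "x - y = of_nat p * u"
    using assms(1) by (auto simp: zcong_def)
  then obtain a b where ab: "u = of_int a / of_int b" "\<not> int p dvd b" "b \<noteq> 0"
    by (elim p_integralE)
  obtain c d where q: "quotient_of (x - y) = (c, d)" by force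
  then have "x - y = of_int c / of_int d" and "d > 0"
    using quotient_of_div quotient_of_denom_pos by auto
  then have "of_int (c * b) = (of_int (int p * (a * d)) :: rat)"
    using u(2) ab by (simp add: field_simps)
  then have "c * b = int p * (a * d)" unfolding of_int_eq_iff .
  then have "int p dvd c * b" by simp
  then have "int p dvd c" using int_prime_p ab(2) prime_dvd_mult_iff by blast
  then show ?thesis using cop assms(2,3) q by (simp add: rat_cong_def)
qed

section \<open>Power sums and harmonic numbers modulo p\<close>

lemma fermat_zcong:
  assumes "0 < j" "j < p"
  shows "of_nat j ^ (p - 1) \<approx> 1"
proof -
  have "\<not> p dvd j" using assms by (auto dest: dvd_imp_le)
  then have "[j ^ (p - 1) = 1] (mod p)" using fermat_theorem prime_p by blast
  from zcong_of_nat[OF this] show ?thesis by simp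
qed

lemma inverse_power_zcong:
  assumes "0 < j" "j < p" "c < p"
  shows "1 / of_nat j ^ c \<approx> of_nat j ^ (p - 1 - c)"
proof -
  have "of_nat j ^ (p - 1) = (of_nat j ^ (p - 1 - c) * of_nat j ^ c :: rat)"
    using assms(3) by (simp flip: power_add)
  then have "of_nat j ^ (p - 1 - c) = (1 / of_nat j ^ c * of_nat j ^ (p - 1) :: rat)"
    using assms(1) by simp
  moreover have "1 / of_nat j ^ c * of_nat j ^ (p - 1) \<approx> 1 / of_nat j ^ c * 1"
    using assms by (intro zcong_scale fermat_zcong p_integral_divide_power) auto
  ultimately show ?thesis by (auto intro: zcong_sym)
qed

text \<open>
  Fermat's theorem reduces the exponent modulo \<open>p - 1\<close>. For a remainder \<open>0 < r < p - 1\<close>,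
  every term of Faulhaber's formula with \<open>n = p\<close> contains the factor \<open>p\<close>, and its Bernoulli
  numbers and the divisor \<open>r + 1\<close> are harmless.
\<close>

lemma power_sum_zcong:
  "(\<Sum>j = 1..p - 1. of_nat j ^ e) \<approx> (if (p - 1) dvd e then - 1 else 0)"
proof -
  define r where "r = e mod (p - 1)"
  have "(\<Sum>j = 1..p - 1. of_nat j ^ e) \<approx> (\<Sum>j = 1..p - 1. of_nat j ^ r)"
  proof (rule zcong_sum)
    fix j assume "j \<in> {1..p - 1}"
    then have j: "0 < j" "j < p" by auto
    have 1: "(of_nat j ^ (p - 1)) ^ q \<approx> 1" for q
      by (induction q) (use zcong_mult[OF fermat_zcong[OF j]] in auto)
    have "e = (p - 1) * (e div (p - 1)) + r" by (simp add: r_def)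
    then have "of_nat j ^ e = (of_nat j ^ r * (of_nat j ^ (p - 1)) ^ (e div (p - 1)) :: rat)"
      by (metis mult.commute power_add power_mult)
    also have "\<dots> \<approx> of_nat j ^ r * 1"
      by (intro zcong_scale 1) auto
    finally show "of_nat j ^ e \<approx> of_nat j ^ r" by simp
  qed
  also have "\<dots> \<approx> (if (p - 1) dvd e then - 1 else 0)"
  proof (cases "r = 0")
    case True
    then have "(p - 1) dvd e" by (auto simp: r_def)
    then show ?thesis using True zcong_p_minus[of 1] p_gt_2 by simp
  next
    case False
    have "r < p - 1" using p_gt_2 by (simp add: r_def)
    define Q where "Q = (\<Sum>i\<le>r. of_nat (Suc r choose i) * bernoulli i * of_nat p ^ (r - i))"
    have Q: "Q \<in> p_integral"
      unfolding Q_def using \<open>r < p - 1\<close>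
      by (intro p_integral_sum p_integral_mult p_integral_bernoulli p_integral_power) auto
    have split: "(\<Sum>j = 1..p - 1. of_nat j ^ r) = (\<Sum>j<p. of_nat j ^ r :: rat)"
      using False by (intro sum.mono_neutral_left) auto
    have "(of_nat p :: rat) ^ (Suc r - i) = of_nat p * of_nat p ^ (r - i)" if "i \<le> r" for i
      using that by (simp add: Suc_diff_le)
    then have "of_nat (Suc r) * (\<Sum>j<p. of_nat j ^ r) = of_nat p * Q"
      unfolding faulhaber[of r p] Q_def sum_distrib_left[of "of_nat p"]
      by (intro sum.cong refl) (simp only: atMost_iff mult_ac)
    then have "of_nat (Suc r) * (\<Sum>j = 1..p - 1. of_nat j ^ r) \<approx> of_nat (Suc r) * 0"
      unfolding split using Q by (intro zcongI[of _ _ Q]) simp_all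
    then have "(\<Sum>j = 1..p - 1. of_nat j ^ r) \<approx> 0"
      by (rule zcong_cancel) (rule not_p_dvd_less, use \<open>r < p - 1\<close> in auto)
    moreover have "\<not> (p - 1) dvd e" using False by (auto simp: r_def dvd_eq_mod_eq_0)
    ultimately show ?thesis by simp
  qed
  finally show ?thesis .
qed

lemma inverse_power_sum_zcong:
  assumes "0 < s" "s < p - 1"
  shows "harmonic s (p - 1) \<approx> 0"
proof -
  have "harmonic s (p - 1) \<approx> (\<Sum>j = 1..p - 1. of_nat j ^ (p - 1 - s))"
    unfolding harmonic_def using assms by (intro zcong_sum inverse_power_zcong) auto
  also have "\<not> (p - 1) dvd (p - 1 - s)" using assms by (auto dest: dvd_imp_le)
  then have "(\<Sum>j = 1..p - 1. of_nat j ^ (p - 1 - s)) \<approx> 0"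
    using power_sum_zcong[of "p - 1 - s"] by simp
  finally show ?thesis .
qed

section \<open>Triple harmonic sums\<close>

definition triple_sum :: "nat \<Rightarrow> nat \<Rightarrow> nat \<Rightarrow> rat" where
  "triple_sum a b c = (\<Sum>j = 1..p - 1. harmonic a j * harmonic b j / of_nat j ^ c)"

definition strict_triple_sum :: "nat \<Rightarrow> nat \<Rightarrow> nat \<Rightarrow> rat" where
  "strict_triple_sum a b c
    = (\<Sum>j = 1..p - 1. harmonic a (j - 1) * harmonic b (j - 1) / of_nat j ^ c)"

definition strict_double_sum :: "nat \<Rightarrow> nat \<Rightarrow> rat" where
  "strict_double_sum a b = (\<Sum>j = 1..p - 1. harmonic a (j - 1) / of_nat j ^ b)"

lemma p_integral_triple_sum [simp, intro]: "triple_sum a b c \<in> p_integral"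
  unfolding triple_sum_def
  by (intro p_integral_sum p_integral_divide_power p_integral_mult p_integral_harmonic) auto

lemma triple_sum_commute: "triple_sum a b c = triple_sum b a c"
  by (simp add: triple_sum_def mult.commute)

lemma inverse_power_reflect:
  assumes "0 < i" "i < p"
  shows "1 / of_nat (p - i) ^ s \<approx> (- 1) ^ s * (1 / of_nat i ^ s)"
proof -
  have u: "1 / of_nat (p - i) \<in> p_integral" "1 / of_nat i \<in> p_integral"
    using assms by (intro p_integral_inverse not_p_dvd_less; simp)+
  have "1 / of_nat (p - i) - (- 1 / of_nat i) = of_nat p * (1 / of_nat (p - i) * (1 / of_nat i :: rat))"
    using assms by (simp add: of_nat_diff field_simps)
  then have "1 / of_nat (p - i) \<approx> - 1 / of_nat i"
    by (rule zcongI) (rule p_integral_mult[OF u])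
  then have "(1 / of_nat (p - i)) ^ s \<approx> (- 1 / of_nat i) ^ s"
    using u p_integral_uminus[OF u(2)] by (intro zcong_power) auto
  moreover have "- 1 / of_nat i = - 1 * (1 / of_nat i :: rat)" by simp
  ultimately show ?thesis by (simp only: power_mult_distrib power_one_over)
qed

text \<open>
  \<open>H\<^sup>(\<^sup>s\<^sup>)\<close> vanishes at \<open>p - 1\<close>, so its value at \<open>p - j\<close> is minus the sum over the top
  \<open>j - 1\<close> indices, which \<open>k \<mapsto> p - k\<close> maps onto the bottom \<open>j - 1\<close> ones.
\<close>

lemma harmonic_reflect:
  assumes "0 < s" "s < p - 1" "0 < j" "j < p"
  shows "harmonic s (p - j) \<approx> - ((- 1) ^ s) * harmonic s (j - 1)"
proof -
  have split: "harmonic s (p - 1) = harmonic s (p - j) + (\<Sum>k = p - j + 1..p - 1. 1 / of_nat k ^ s)"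
  proof -
    have "{1..p - 1} = {1..p - j} \<union> {p - j + 1..p - 1}" using assms by auto
    then show ?thesis by (simp add: harmonic_def sum.union_disjoint)
  qed
  have "(\<Sum>k = p - j + 1..p - 1. 1 / of_nat k ^ s) = (\<Sum>i = 1..j - 1. 1 / of_nat (p - i) ^ s :: rat)"
    using assms by (intro sum.reindex_bij_witness[of _ "\<lambda>i. p - i" "\<lambda>i. p - i"]) auto
  also have "\<dots> \<approx> (\<Sum>i = 1..j - 1. (- 1) ^ s * (1 / of_nat i ^ s))"
    using assms by (intro zcong_sum inverse_power_reflect) auto
  also have "\<dots> = (- 1) ^ s * harmonic s (j - 1)"
    by (simp add: harmonic_def sum_distrib_left)
  finally have tail: "(\<Sum>k = p - j + 1..p - 1. 1 / of_nat k ^ s) \<approx> (- 1) ^ s * harmonic s (j - 1)" .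
  have "harmonic s (p - 1) - (\<Sum>k = p - j + 1..p - 1. 1 / of_nat k ^ s)
      \<approx> 0 - ((- 1) ^ s) * harmonic s (j - 1)"
    by (intro zcong_diff inverse_power_sum_zcong tail assms)
  moreover have "harmonic s (p - 1) - (\<Sum>k = p - j + 1..p - 1. 1 / of_nat k ^ s) = harmonic s (p - j)"
    unfolding split by simp
  ultimately show ?thesis by simp
qed

lemma triple_sum_reflect:
  assumes "0 < a" "a < p - 1" "0 < b" "b < p - 1"
  shows "triple_sum a b c \<approx> (- 1) ^ (a + b + c) * strict_triple_sum a b c"
proof -
  have "triple_sum a b c = (\<Sum>j = 1..p - 1. (harmonic a (p - j) * harmonic b (p - j)) * (1 / of_nat (p - j) ^ c))"
    unfolding triple_sum_def
    by (intro sum.reindex_bij_witness[of _ "\<lambda>i. p - i" "\<lambda>i. p - i"]) auto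
  also have "\<dots> \<approx> (\<Sum>j = 1..p - 1. ((- ((- 1) ^ a) * harmonic a (j - 1)) * (- ((- 1) ^ b) * harmonic b (j - 1)))
      * ((- 1) ^ c * (1 / of_nat j ^ c)))"
  proof (rule zcong_sum)
    fix j assume "j \<in> {1..p - 1}"
    then have j: "0 < j" "j < p" "0 < p - j" "p - j < p" "j - 1 < p" by auto
    have i: "- ((- 1) ^ n) \<in> p_integral" for n
      by (intro p_integral_uminus p_integral_power p_integral_numeral)
    note h = p_integral_harmonic[OF j(4)] p_integral_mult[OF i p_integral_harmonic[OF j(5)]]
    show "(harmonic a (p - j) * harmonic b (p - j)) * (1 / of_nat (p - j) ^ c)
      \<approx> ((- ((- 1) ^ a) * harmonic a (j - 1)) * (- ((- 1) ^ b) * harmonic b (j - 1)))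
      * ((- 1) ^ c * (1 / of_nat j ^ c))"
      using assms j(1,2)
      by (intro zcong_mult inverse_power_reflect harmonic_reflect h p_integral_mult[OF h(2) h(2)]
        p_integral_divide_power j p_integral_numeral)
  qed
  also have "\<dots> = (- 1) ^ (a + b + c) * strict_triple_sum a b c"
  proof -
    have "(- s * x) * (- t * y) * (u * (1 / z)) = (s * t * u) * (x * y / z)" for s t u x y z :: rat
      by simp
    then show ?thesis
      unfolding strict_triple_sum_def sum_distrib_left power_add by (simp only:)
  qed
  finally show ?thesis .
qed

lemma triple_sum_decompose:
  "triple_sum a b c = strict_triple_sum a b c + strict_double_sum a (b + c)
     + strict_double_sum b (a + c) + harmonic (a + b + c) (p - 1)"
  unfolding triple_sum_def strict_triple_sum_def strict_double_sum_def harmonic_def[of "a + b + c"]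
    sum.distrib[symmetric]
  by (intro sum.cong refl) (simp add: harmonic_step power_add field_simps)

text \<open>
  Telescoping \<open>H\<^sup>(\<^sup>a\<^sup>) H\<^sup>(\<^sup>b\<^sup>) H\<^sup>(\<^sup>c\<^sup>)\<close> gives its value at \<open>p - 1\<close>, which vanishes. In the
  average of the expansions of each difference around \<open>j\<close> and around \<open>j - 1\<close> the double
  sums cancel, and what remains is \<open>1/j\<^sup>w\<close> and the means of the weak and the strict triple
  sums. In even weight the reflection identifies these two.
\<close>

lemma triple_sum_cyclic:
  assumes "0 < a" "0 < b" "0 < c" "a + b + c < p - 1" "even (a + b + c)"
  shows "triple_sum a b c + triple_sum a c b + triple_sum b c a \<approx> 0"
proof -
  let ?g = "\<lambda>j. harmonic a j * harmonic b j * harmonic c j"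
  have tele: "(\<Sum>j = 1..n. ?g j - ?g (j - 1)) = ?g n" for n
    by (induction n) simp_all
  have step: "2 * (?g j - ?g (j - 1)) =
      (harmonic a j * harmonic b j / of_nat j ^ c + harmonic a (j - 1) * harmonic b (j - 1) / of_nat j ^ c)
    + (harmonic a j * harmonic c j / of_nat j ^ b + harmonic a (j - 1) * harmonic c (j - 1) / of_nat j ^ b)
    + (harmonic b j * harmonic c j / of_nat j ^ a + harmonic b (j - 1) * harmonic c (j - 1) / of_nat j ^ a)
    - 1 / of_nat j ^ (a + b + c)" if "j \<in> {1..p - 1}" for j
  proof -
    define u v w :: rat where "u = 1 / of_nat j ^ a" "v = 1 / of_nat j ^ b" "w = 1 / of_nat j ^ c"
    have "1 / of_nat j ^ (a + b + c) = u * v * w" by (simp add: u_v_w_def power_add)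
    moreover have "x / of_nat j ^ a = x * u" "x / of_nat j ^ b = x * v" "x / of_nat j ^ c = x * w" for x
      by (simp_all add: u_v_w_def)
    moreover have "harmonic a j = harmonic a (j - 1) + u" "harmonic b j = harmonic b (j - 1) + v"
      "harmonic c j = harmonic c (j - 1) + w"
      using that by (simp_all add: u_v_w_def harmonic_step)
    ultimately show ?thesis by (simp only:) (simp add: algebra_simps)
  qed
  have "2 * ?g (p - 1) = (\<Sum>j = 1..p - 1. 2 * (?g j - ?g (j - 1)))"
    using tele[of "p - 1"] by (simp only: sum_distrib_left[symmetric])
  also have "\<dots> = (triple_sum a b c + strict_triple_sum a b c) + (triple_sum a c b + strict_triple_sum a c b)
     + (triple_sum b c a + strict_triple_sum b c a) - harmonic (a + b + c) (p - 1)"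
    unfolding triple_sum_def strict_triple_sum_def harmonic_def[of "a + b + c"]
      sum.distrib[symmetric] sum_subtractf[symmetric]
    by (intro sum.cong refl step)
  finally have eq: "(triple_sum a b c + strict_triple_sum a b c) + (triple_sum a c b + strict_triple_sum a c b)
     + (triple_sum b c a + strict_triple_sum b c a) = 2 * ?g (p - 1) + harmonic (a + b + c) (p - 1)"
    by simp
  have strict: "triple_sum a' b' c' \<approx> strict_triple_sum a' b' c'"
    if "0 < a'" "0 < b'" "a' + b' + c' = a + b + c" for a' b' c'
    using triple_sum_reflect[of a' b' c'] that assms by auto
  have "of_nat 2 * (triple_sum a b c + triple_sum a c b + triple_sum b c a)
    = (triple_sum a b c + triple_sum a b c) + (triple_sum a c b + triple_sum a c b)
     + (triple_sum b c a + triple_sum b c a)" by simp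
  also have "\<dots> \<approx> (triple_sum a b c + strict_triple_sum a b c) + (triple_sum a c b + strict_triple_sum a c b)
     + (triple_sum b c a + strict_triple_sum b c a)"
    using assms by (intro zcong_add zcong_refl strict) auto
  \<comment> \<open>A single vanishing factor of the telescoped product is enough.\<close>
  also have "\<dots> \<approx> 2 * (0 * (harmonic b (p - 1) * harmonic c (p - 1))) + 0"
    unfolding eq mult.assoc using assms p_gt_2
    by (intro zcong_add zcong_scale zcong_mult inverse_power_sum_zcong zcong_refl
        p_integral_mult p_integral_harmonic) auto
  finally have "of_nat 2 * (triple_sum a b c + triple_sum a c b + triple_sum b c a) \<approx> of_nat 2 * 0"
    by simp
  then show ?thesis
    by (rule zcong_cancel) (rule not_p_dvd_less, use p_gt_2 in auto)
qed

section \<open>Expansion of harmonic sums in Bernoulli numbers\<close>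

lemma p_integral_negbinom [simp, intro]: "negbinom a i \<in> p_integral"
  by (simp add: negbinom_def)

text \<open>
  The binomial coefficient is a polynomial in its upper index with denominator \<open>i!\<close>, and \<open>i < p\<close>,
  so the upper index \<open>p - a\<close> may be replaced by \<open>- a\<close>.
\<close>

lemma choose_p_minus_zcong:
  assumes "0 < a" "a < p" "i + a \<le> p"
  shows "of_nat (p - a choose i) \<approx> (- 1) ^ i * negbinom a i"
proof -
  have "of_nat (fact i) * of_nat (p - a choose i) \<approx> of_nat (fact i) * ((- 1) ^ i * of_nat (a + i - 1 choose i))"
    using assms(3)
  proof (induction i)
    case (Suc i)
    have 1: "fact (Suc i) * (p - a choose Suc i) = (p - (a + i)) * (fact i * (p - a choose i))"
    proof -
      have "Suc i * (p - a choose Suc i) = (p - a - i) * (p - a choose i)"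
        using binomial_absorb_comp[of "p - a" i] binomial_absorption[of i "p - a"] by simp
      then have "fact i * (Suc i * (p - a choose Suc i)) = fact i * ((p - a - i) * (p - a choose i))"
        by simp
      then show ?thesis by (simp only: fact_Suc mult_ac diff_diff_left of_nat_id)
    qed
    have 2: "fact (Suc i) * (a + Suc i - 1 choose Suc i) = (a + i) * (fact i * (a + i - 1 choose i))"
    proof -
      have "Suc i * (a + i choose Suc i) = (a + i) * (a + i - 1 choose i)"
        using binomial_absorption[of i "a + i"] assms(1) by auto
      then have "fact i * (Suc i * (a + i choose Suc i)) = fact i * ((a + i) * (a + i - 1 choose i))"
        by simp
      moreover have "a + Suc i - 1 = a + i" by simp
      ultimately show ?thesis by (simp only: fact_Suc mult_ac of_nat_id)
    qed
    have "of_nat (fact (Suc i)) * of_nat (p - a choose Suc i)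
        = (of_nat (p - (a + i)) * (of_nat (fact i) * of_nat (p - a choose i)) :: rat)"
      using 1 by (metis of_nat_mult)
    also have "\<dots> \<approx> - of_nat (a + i) * (of_nat (fact i) * ((- 1) ^ i * of_nat (a + i - 1 choose i)))"
      using Suc by (intro zcong_mult[OF zcong_p_minus Suc.IH]) auto
    also have "\<dots> = (- 1) ^ Suc i * of_nat ((a + i) * (fact i * (a + i - 1 choose i)))"
      by (simp del: of_nat_add)
    also have "\<dots> = of_nat (fact (Suc i)) * ((- 1) ^ Suc i * of_nat (a + Suc i - 1 choose Suc i))"
      unfolding 2[symmetric] by simp
    finally show ?case .
  qed simp
  moreover have "\<not> p dvd fact i"
    using assms by (simp add: prime_dvd_fact_iff prime_p)
  ultimately show ?thesis unfolding negbinom_def by (rule zcong_cancel)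
qed

text \<open>
  Faulhaber's formula for the exponent \<open>p - 1 - a\<close>, to which Fermat's theorem reduces
  \<open>- a\<close>. This is the Euler-Maclaurin expansion of \<open>H\<^sup>(\<^sup>a\<^sup>)\<close> in powers of \<open>1/j\<close>, read modulo
  \<open>p\<close>.
\<close>

lemma harmonic_zcong_bernoulli:
  assumes "0 < a" "a + 1 < p" "0 < j" "j < p"
  shows "of_nat a * harmonic a (j - 1)
    \<approx> - (\<Sum>i\<le>p - 1 - a. (- 1) ^ i * negbinom a i * bernoulli i * of_nat j ^ (p - a - i))"
proof -
  define m where "m = p - 1 - a"
  have m: "0 < m" "Suc m = p - a" using assms by (auto simp: m_def)
  have "harmonic a (j - 1) \<approx> (\<Sum>k = 1..j - 1. of_nat k ^ m)"
    unfolding harmonic_def m_def using assms by (intro zcong_sum inverse_power_zcong) auto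
  also have "(\<Sum>k = 1..j - 1. of_nat k ^ m) = (\<Sum>k<j. of_nat k ^ m :: rat)"
    using m assms by (intro sum.mono_neutral_left) auto
  finally have h: "harmonic a (j - 1) \<approx> (\<Sum>k<j. of_nat k ^ m)" .
  have "of_nat a * harmonic a (j - 1) = - (- of_nat a * harmonic a (j - 1))" by simp
  also have "\<dots> \<approx> - (of_nat (p - a) * (\<Sum>k<j. of_nat k ^ m))"
    using assms h by (intro zcong_uminus zcong_mult zcong_sym[OF zcong_p_minus] p_integral_sum) auto
  also have "\<dots> = - (\<Sum>i\<le>m. of_nat (p - a choose i) * bernoulli i * of_nat j ^ (p - a - i))"
    using faulhaber[of m j] m by simp
  also have "\<dots> \<approx> - (\<Sum>i\<le>m. (- 1) ^ i * negbinom a i * bernoulli i * of_nat j ^ (p - a - i))"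
    using assms m
    by (intro zcong_uminus zcong_sum zcong_mult choose_p_minus_zcong p_integral_mult p_integral_bernoulli) auto
  finally show ?thesis by (simp add: m_def)
qed

lemma neg_one_power_p_minus: "k \<le> p \<Longrightarrow> (- 1) ^ (p - k) = - ((- 1) ^ k :: rat)"
proof -
  assume "k \<le> p"
  then have "(- 1) ^ p = ((- 1) ^ (p - k) * (- 1) ^ k :: rat)"
    by (simp flip: power_add)
  moreover have "odd p" using prime_p p_gt_2 prime_odd_nat by blast
  ultimately have "(- 1) ^ (p - k) * (- 1) ^ k * (- 1) ^ k = - ((- 1) ^ k :: rat)" by simp
  then show ?thesis by (simp add: mult.assoc flip: power_mult_distrib)
qed

text \<open>
  After summation over \<open>j\<close> only one exponent in the expansion of \<open>H\<^sup>(\<^sup>a\<^sup>)\<close> is a multiple of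
  \<open>p - 1\<close>: the one belonging to \<open>B\<^bsub>p-a-b\<^esub>\<close>.
\<close>

lemma strict_double_sum_zcong:
  assumes "0 < a" "0 < b" "a + b < p"
  shows "of_nat a * strict_double_sum a b
    \<approx> - ((- 1) ^ (a + b)) * negbinom a (p - (a + b)) * bernoulli (p - (a + b))"
proof -
  define t where "t i = (- 1) ^ i * negbinom a i * bernoulli i" for i
  have t: "t i \<in> p_integral" if "i \<le> p - 1 - a" for i
    unfolding t_def using that assms by (intro p_integral_mult p_integral_bernoulli p_integral_power) auto
  have "of_nat a * strict_double_sum a b
      = (\<Sum>j = 1..p - 1. (of_nat a * harmonic a (j - 1)) * (1 / of_nat j ^ b))"
    by (simp add: strict_double_sum_def sum_distrib_left)
  also have "\<dots> \<approx> (\<Sum>j = 1..p - 1. - (\<Sum>i\<le>p - 1 - a. t i * of_nat j ^ (p - a - i)) * of_nat j ^ (p - 1 - b))"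
    unfolding t_def using assms
    by (intro zcong_sum zcong_mult harmonic_zcong_bernoulli inverse_power_zcong
        p_integral_uminus p_integral_sum p_integral_mult p_integral_bernoulli p_integral_divide_power) auto
  also have "\<dots> = - (\<Sum>i\<le>p - 1 - a. t i * (\<Sum>j = 1..p - 1. of_nat j ^ ((p - a - i) + (p - 1 - b))))"
    by (simp add: sum_distrib_left sum_distrib_right power_add mult.assoc sum_negf) (rule sum.swap)
  also have "\<dots> \<approx> - (\<Sum>i\<le>p - 1 - a. t i * (if (p - 1) dvd ((p - a - i) + (p - 1 - b)) then - 1 else 0))"
    by (intro zcong_uminus zcong_sum zcong_scale power_sum_zcong t) auto
  also have "\<dots> = - (\<Sum>i\<le>p - 1 - a. if i = p - (a + b) then - t i else 0)"
  proof -
    have "(p - 1) dvd ((p - a - i) + (p - 1 - b)) \<longleftrightarrow> i = p - (a + b)" if "i \<le> p - 1 - a" for i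
    proof
      assume "(p - 1) dvd ((p - a - i) + (p - 1 - b))"
      then obtain q where q: "(p - a - i) + (p - 1 - b) = (p - 1) * q" by (elim dvdE)
      have "0 < (p - a - i) + (p - 1 - b)" "(p - a - i) + (p - 1 - b) < (p - 1) * 2"
        using that assms by auto
      then have "0 < q" "q < 2" unfolding q by auto
      then have "q = 1" by simp
      then show "i = p - (a + b)" using q that assms by auto
    next
      assume "i = p - (a + b)"
      then have "(p - a - i) + (p - 1 - b) = p - 1" using that assms by auto
      then show "(p - 1) dvd ((p - a - i) + (p - 1 - b))" by simp
    qed
    then show ?thesis by (intro arg_cong[of _ _ uminus] sum.cong) auto
  qed
  also have "\<dots> = t (p - (a + b))"
    using assms by (subst sum.delta) auto
  finally show ?thesis using assms by (simp add: t_def neg_one_power_p_minus)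
qed

text \<open>
  The contribution of the index pairs \<open>i = p - s\<close> and \<open>k = p - (w - s)\<close>, whose sum is
  \<open>2 p - w\<close>. The range of \<open>s\<close> says that \<open>i \<le> p - 1 - a\<close> and \<open>k \<le> p - 1 - b\<close>, the largest
  indices in the expansions of the two harmonic numbers.
\<close>

definition bernoulli_tail :: "nat \<Rightarrow> nat \<Rightarrow> nat \<Rightarrow> rat" where
  "bernoulli_tail a b w = (\<Sum>s = a + 1..<w - b.
     negbinom a (p - s) * bernoulli (p - s) * (negbinom b (p - (w - s)) * bernoulli (p - (w - s))))"

text \<open>
  Expand both harmonic numbers. The term with \<open>B\<^sub>i B\<^sub>k\<close> carries
  \<open>j\<close> to the power \<open>3 p - 1 - w - i - k\<close>, which lies strictly between \<open>0\<close> and \<open>3 (p - 1)\<close>. So it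
  survives the summation over \<open>j\<close> only if this exponent is \<open>2 (p - 1)\<close>, which gives the
  convolution, or \<open>p - 1\<close>, which gives the tail.
\<close>

lemma strict_triple_sum_zcong:
  assumes "0 < a" "0 < b" "0 < c" and w: "w = a + b + c" "w < p"
  shows "of_nat (a * b) * strict_triple_sum a b c
    \<approx> - ((- 1) ^ w) * (bernoulli_conv a b (p + 1 - w) + bernoulli_tail a b w)"
proof -
  define t where "t a i = (- 1) ^ i * negbinom a i * bernoulli i" for a i
  have t: "t a i \<in> p_integral" if "i \<le> p - 1 - a" "0 < a" "a < p" for a i
    unfolding t_def using that by (intro p_integral_mult p_integral_bernoulli p_integral_power) auto
  let ?I = "{..p - 1 - a} \<times> {..p - 1 - b}"
  let ?e = "\<lambda>(i, k). (p - a - i) + (p - b - k) + (p - 1 - c)"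
  have "of_nat (a * b) * strict_triple_sum a b c = (\<Sum>j = 1..p - 1.
       ((of_nat a * harmonic a (j - 1)) * (of_nat b * harmonic b (j - 1))) * (1 / of_nat j ^ c))"
    by (simp add: strict_triple_sum_def sum_distrib_left mult_ac)
  also have "\<dots> \<approx> (\<Sum>j = 1..p - 1. ((- (\<Sum>i\<le>p - 1 - a. t a i * of_nat j ^ (p - a - i)))
       * (- (\<Sum>k\<le>p - 1 - b. t b k * of_nat j ^ (p - b - k)))) * of_nat j ^ (p - 1 - c))"
    unfolding t_def using assms
    by (intro zcong_sum zcong_mult harmonic_zcong_bernoulli inverse_power_zcong
        p_integral_uminus p_integral_sum p_integral_mult p_integral_bernoulli
        p_integral_harmonic p_integral_divide_power) auto
  also have "\<dots> = (\<Sum>j = 1..p - 1. \<Sum>x\<in>?I. (t a (fst x) * t b (snd x)) * of_nat j ^ ?e x)"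
  proof (rule sum.cong[OF refl])
    fix j
    have product: "(\<Sum>i\<le>p - 1 - a. f i) * (\<Sum>k\<le>p - 1 - b. g k) = (\<Sum>x\<in>?I. f (fst x) * g (snd x))"
      for f g :: "nat \<Rightarrow> rat"
      by (simp add: sum_product sum.cartesian_product case_prod_unfold)
    show "((- (\<Sum>i\<le>p - 1 - a. t a i * of_nat j ^ (p - a - i)))
       * (- (\<Sum>k\<le>p - 1 - b. t b k * of_nat j ^ (p - b - k)))) * of_nat j ^ (p - 1 - c)
      = (\<Sum>x\<in>?I. (t a (fst x) * t b (snd x)) * of_nat j ^ ?e x)"
      unfolding minus_mult_minus product unfolding sum_distrib_right
      by (intro sum.cong refl) (auto simp: power_add)
  qed
  also have "\<dots> = (\<Sum>x\<in>?I. (t a (fst x) * t b (snd x)) * (\<Sum>j = 1..p - 1. of_nat j ^ ?e x))"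
    unfolding sum_distrib_left by (rule sum.swap)
  also have "\<dots> \<approx> (\<Sum>x\<in>?I. (t a (fst x) * t b (snd x)) * (if (p - 1) dvd ?e x then - 1 else 0))"
    using assms by (intro zcong_sum zcong_scale power_sum_zcong p_integral_mult t) auto
  also have "\<dots> = - (\<Sum>x\<in>{x\<in>?I. (p - 1) dvd ?e x}. t a (fst x) * t b (snd x))"
    unfolding sum_negf[symmetric]
    by (intro sum.mono_neutral_cong_right) auto
  also have "{x\<in>?I. (p - 1) dvd ?e x} = (\<lambda>i. (i, p + 1 - w - i)) ` {..p + 1 - w}
      \<union> (\<lambda>s. (p - s, p - (w - s))) ` {a + 1..<w - b}" (is "?D = ?D1 \<union> ?D2")
  proof (intro equalityI subsetI)
    fix x assume "x \<in> ?D"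
    then obtain i k where x: "x = (i, k)" and ik: "i \<le> p - 1 - a" "k \<le> p - 1 - b"
      and "(p - 1) dvd ?e (i, k)" by auto
    then obtain q where q: "?e (i, k) = (p - 1) * q" by (elim dvdE)
    have "0 < ?e (i, k)" "?e (i, k) < (p - 1) * 3" using ik assms by auto
    then have "0 < q" "q < 3" unfolding q by auto
    then consider "q = 1" | "q = 2" by linarith
    then show "x \<in> ?D1 \<union> ?D2"
    proof cases
      case 1
      then have "i + k + w = 2 * p" using q ik assms by auto
      then have "x = (\<lambda>s. (p - s, p - (w - s))) (p - i)" "p - i \<in> {a + 1..<w - b}"
        using ik assms x by auto
      then show ?thesis by blast
    next
      case 2
      then have "i + k + w = p + 1" using q ik assms by auto
      then have "x = (\<lambda>i. (i, p + 1 - w - i)) i" "i \<in> {..p + 1 - w}"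
        using x by auto
      then show ?thesis by blast
    qed
  next
    fix x assume "x \<in> ?D1 \<union> ?D2"
    then show "x \<in> ?D"
    proof
      assume "x \<in> ?D1"
      then obtain i where x: "x = (i, p + 1 - w - i)" "i \<le> p + 1 - w" by auto
      then have "?e x = (p - 1) * 2" using assms by auto
      then show ?thesis using x assms by auto
    next
      assume "x \<in> ?D2"
      then obtain s where x: "x = (p - s, p - (w - s))" "a + 1 \<le> s" "s < w - b" by auto
      then have "?e x = p - 1" using assms by auto
      then show ?thesis using x assms by auto
    qed
  qed
  also have "- (\<Sum>x\<in>?D1 \<union> ?D2. t a (fst x) * t b (snd x))
     = - ((\<Sum>x\<in>?D1. t a (fst x) * t b (snd x)) + (\<Sum>x\<in>?D2. t a (fst x) * t b (snd x)))"
    using assms by (subst sum.union_disjoint) auto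
  also have "(\<Sum>x\<in>?D1. t a (fst x) * t b (snd x)) = (- 1) ^ w * bernoulli_conv a b (p + 1 - w)"
  proof -
    have "(- 1) ^ i * (- 1) ^ (p + 1 - w - i) = ((- 1) ^ w :: rat)" if "i \<le> p + 1 - w" for i
    proof -
      have "(- 1) ^ i * (- 1) ^ (p + 1 - w - i) = ((- 1) ^ Suc (p - w) :: rat)"
        unfolding power_add[symmetric] using that w by (intro arg_cong[of _ _ "power _"]) auto
      then show ?thesis using w by (simp add: neg_one_power_p_minus)
    qed
    note sgn = this
    have "(\<Sum>x\<in>?D1. t a (fst x) * t b (snd x)) = (\<Sum>i\<le>p + 1 - w. t a i * t b (p + 1 - w - i))"
      by (subst sum.reindex) (auto simp: inj_on_def)
    also have "\<dots> = (\<Sum>i\<le>p + 1 - w. ((- 1) ^ i * (- 1) ^ (p + 1 - w - i)) * (negbinom a i * bernoulli i *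
        (negbinom b (p + 1 - w - i) * bernoulli (p + 1 - w - i))))"
      unfolding t_def by (intro sum.cong refl) (simp only: mult_ac)
    also have "\<dots> = (- 1) ^ w * bernoulli_conv a b (p + 1 - w)"
      unfolding bernoulli_conv_def sum_distrib_left
      by (intro sum.cong refl) (use sgn in auto)
    finally show ?thesis .
  qed
  also have "(\<Sum>x\<in>?D2. t a (fst x) * t b (snd x)) = (- 1) ^ w * bernoulli_tail a b w"
  proof -
    have "(- 1) ^ (p - s) * (- 1) ^ (p - (w - s)) = ((- 1) ^ w :: rat)" if "s < w - b" for s
    proof -
      have "(- 1) ^ (p - s) * (- 1) ^ (p - (w - s)) = ((- 1) ^ s * (- 1) ^ (w - s) :: rat)"
        using neg_one_power_p_minus[of s] neg_one_power_p_minus[of "w - s"] that w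
        by (simp only: minus_mult_minus)
      also have "\<dots> = (- 1) ^ w"
        unfolding power_add[symmetric] using that by (intro arg_cong[of _ _ "power _"]) auto
      finally show ?thesis .
    qed
    note sgn = this
    have "(\<Sum>x\<in>?D2. t a (fst x) * t b (snd x)) = (\<Sum>s = a + 1..<w - b. t a (p - s) * t b (p - (w - s)))"
      using w by (subst sum.reindex) (auto simp: inj_on_def)
    also have "\<dots> = (\<Sum>s = a + 1..<w - b. ((- 1) ^ (p - s) * (- 1) ^ (p - (w - s))) *
       (negbinom a (p - s) * bernoulli (p - s) * (negbinom b (p - (w - s)) * bernoulli (p - (w - s)))))"
      unfolding t_def by (intro sum.cong refl) (simp only: mult_ac)
    also have "\<dots> = (- 1) ^ w * bernoulli_tail a b w"
      unfolding bernoulli_tail_def sum_distrib_left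
      by (intro sum.cong refl) (use sgn in auto)
    finally show ?thesis .
  qed
  finally show ?thesis by (simp add: algebra_simps)
qed

lemma triple_sum_zcong_bernoulli:
  assumes "0 < a" "0 < b" "0 < c" and w: "w = a + b + c" "w < p" "even w"
  shows "of_nat (a * b) * triple_sum a b c
    \<approx> - (bernoulli_conv a b (p + 1 - w) + bernoulli_tail a b w)"
proof -
  have "triple_sum a b c \<approx> (- 1) ^ w * strict_triple_sum a b c"
    using triple_sum_reflect[of a b c] assms by simp
  then have "of_nat (a * b) * triple_sum a b c \<approx> of_nat (a * b) * strict_triple_sum a b c"
    using w(3) by (intro zcong_scale) auto
  also have "\<dots> \<approx> - (bernoulli_conv a b (p + 1 - w) + bernoulli_tail a b w)"
    using strict_triple_sum_zcong[of a b c w] assms by simp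
  finally show ?thesis .
qed

lemma p_integral_bernoulli_conv [intro]: "n + 2 \<le> p \<Longrightarrow> bernoulli_conv a b n \<in> p_integral"
  unfolding bernoulli_conv_def
  by (intro p_integral_sum p_integral_mult p_integral_bernoulli p_integral_negbinom) auto

lemma bernoulli_p_minus_even:
  assumes "even k" "k + 3 \<le> p"
  shows "bernoulli (p - k) = 0"
proof (rule bernoulli_odd)
  have "odd p" using prime_p p_gt_2 prime_odd_nat by blast
  then show "odd (p - k)" using assms by simp
qed (use assms in simp)

section \<open>Triple sums of weights 5, 6 and 12\<close>

text \<open>
  In odd weight, reflection turns the comparison of the weak and the strict triple sum into
  a formula for twice the triple sum, by double sums alone.
\<close>

lemma triple_sum_zcong_weight_5:
  assumes "11 \<le> p"
  shows "triple_sum 1 2 2 \<approx> - (1 / 2) * bernoulli (p - 5)"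
proof -
  let ?B = "bernoulli (p - 5)"
  have B: "?B \<in> p_integral" using assms by auto
  have 1: "strict_double_sum 1 4 \<approx> ?B"
    using strict_double_sum_zcong[of 1 4] assms by (simp add: negbinom_def)
  have "of_nat 2 * strict_double_sum 2 3 \<approx> of_nat (p - 4) * ?B"
    using strict_double_sum_zcong[of 2 3] assms by (simp add: negbinom_def of_nat_diff)
  also have "\<dots> \<approx> - of_nat 4 * ?B" using assms B by (intro zcong_p_minus_mult) auto
  also have "\<dots> = of_nat 2 * (- 2 * ?B)" by simp
  finally have 2: "strict_double_sum 2 3 \<approx> - 2 * ?B"
    by (rule zcong_cancel) (rule not_p_dvd_less, use p_gt_2 in auto)
  have 3: "triple_sum 1 2 2 \<approx> - strict_triple_sum 1 2 2"
    using triple_sum_reflect[of 1 2 2] assms by simp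
  have 4: "harmonic 5 (p - 1) \<approx> 0"
    using assms by (intro inverse_power_sum_zcong) auto
  have dec: "triple_sum 1 2 2 = strict_triple_sum 1 2 2 + strict_double_sum 1 4
     + strict_double_sum 2 3 + harmonic 5 (p - 1)"
    using triple_sum_decompose[of 1 2 2] by (simp add: eval_nat_numeral)
  have "of_nat 2 * triple_sum 1 2 2 \<approx> of_nat 2 * (- (1 / 2) * ?B)"
    by (rule zcong_rearrange[OF zcong_add[OF 3 zcong_add[OF zcong_add[OF 1 2] 4]]])
       (use dec in simp)
  then show ?thesis
    by (rule zcong_cancel) (rule not_p_dvd_less, use p_gt_2 in auto)
qed

text \<open>
  The five sums are expressed by the convolutions \<open>T\<close>, \<open>V\<close>, \<open>C\<close> for \<open>(1, 1)\<close>, \<open>(2, 2)\<close>,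
  \<open>(2, 1)\<close> and by \<open>X\<close>. The factors \<open>- 2\<close>, \<open>- 3\<close>, \<open>- 1\<close> stem from \<open>n = p - 5\<close> in the Euler
  identities, where \<open>n + 3\<close>, \<open>n + 2\<close> and \<open>n + 4\<close> occur. Of the tails, only the term
  for the index pair \<open>(p - 3, p - 3)\<close> has even indices; it is a multiple of \<open>X\<close>, with a
  factor \<open>p - 2\<close> from each weight \<open>negbinom 2 (p - 3)\<close>.
\<close>

lemma triple_sums_zcong_weight_6:
  assumes "11 \<le> p"
  defines "X \<equiv> (bernoulli (p - 3))\<^sup>2"
  shows "2 * triple_sum 2 1 3 \<approx> X"
    and "- 3 * triple_sum 3 1 2 \<approx> X"
    and "- 6 * triple_sum 3 2 1 \<approx> X"
    and "- 3 * triple_sum 1 1 4 \<approx> X"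
    and "6 * triple_sum 4 1 1 \<approx> X"
proof -
  define T where "T = bernoulli_conv 1 1 (p - 5)"
  define V where "V = bernoulli_conv 2 2 (p - 5)"
  define C where "C = bernoulli_conv 2 1 (p - 5)"
  have int: "X \<in> p_integral" "T \<in> p_integral" "V \<in> p_integral" "C \<in> p_integral"
    unfolding X_def T_def V_def C_def
    by (intro p_integral_bernoulli_conv p_integral_power p_integral_bernoulli;
        use assms(1) in simp)+
  have odd0: "bernoulli (p - 2) = 0" "bernoulli (p - 4) = 0"
    using assms(1) by (auto intro!: bernoulli_p_minus_even)
  have minus: "of_nat (p - k) * x \<approx> - of_nat k * x" if "x \<in> p_integral" "k \<le> 6" for x k
    using that assms(1) by (intro zcong_p_minus_mult) auto
  have cancel: "x \<approx> y" if "of_nat k * x \<approx> of_nat k * y" "0 < k" "k \<le> 6" for x y k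
    using that(1) by (rule zcong_cancel) (rule not_p_dvd_less, use that assms(1) in auto)
  have main: "of_nat (a * b) * triple_sum a b c
      \<approx> - (bernoulli_conv a b (p - 5) + bernoulli_tail a b 6)"
    if "0 < a" "0 < b" "0 < c" "a + b + c = 6" for a b c
    using triple_sum_zcong_bernoulli[of a b c 6] that assms(1) by simp
  have T: "triple_sum 1 1 4 \<approx> - (T + X)"
  proof -
    have "{1 + 1..<6 - 1} = {2, 3, 4::nat}" by auto
    then have "bernoulli_tail 1 1 6 = X"
      unfolding bernoulli_tail_def by (simp add: odd0 negbinom_def X_def power2_eq_square)
    then show ?thesis using main[of 1 1 4] by (simp add: T_def)
  qed
  have C: "2 * C \<approx> - 3 * T"
  proof -
    have "2 * C = of_nat (p - 3) * T"
      using bernoulli_conv_diagonal[of 1 "p - 5"] assms(1)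
      by (simp add: T_def C_def numeral_2_eq_2 [symmetric])
    also have "\<dots> \<approx> - of_nat 3 * T" using int by (intro minus) auto
    finally show ?thesis by simp
  qed
  have f213: "4 * triple_sum 2 1 3 \<approx> 3 * T + 4 * X"
  proof -
    have "{3..<5} = {3, 4::nat}" by auto
    then have "bernoulli_tail 2 1 6 = of_nat (p - 2) * X"
      using assms(1)
      by (simp add: bernoulli_tail_def odd0 negbinom_def X_def power2_eq_square of_nat_diff)
    then have "2 * triple_sum 2 1 3 \<approx> - (C + of_nat (p - 2) * X)"
      using main[of 2 1 3] by (simp add: C_def)
    also have "\<dots> \<approx> - (C + - of_nat 2 * X)"
      using int by (intro zcong_uminus zcong_add minus) auto
    finally show ?thesis
      by (rule zcong_combine[OF _ C, of _ _ 2 "- 1"]) auto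
  qed
  have V: "V \<approx> - 4 * X"
  proof -
    have "{3..<4} = {3::nat}" by auto
    then have "bernoulli_tail 2 2 6 = of_nat (p - 2) * (of_nat (p - 2) * X)"
      using assms(1)
      by (simp add: bernoulli_tail_def negbinom_def X_def power2_eq_square of_nat_diff)
    then have "4 * triple_sum 2 2 2 \<approx> - (V + of_nat (p - 2) * (of_nat (p - 2) * X))"
      using main[of 2 2 2] by (simp add: V_def)
    also have "\<dots> \<approx> - (V + - of_nat 2 * (of_nat (p - 2) * X))"
      using int by (intro zcong_uminus zcong_add minus) auto
    also have "\<dots> \<approx> - (V + - of_nat 2 * (- of_nat 2 * X))"
      using int by (intro zcong_uminus zcong_add zcong_scale minus) auto
    finally have 1: "4 * triple_sum 2 2 2 \<approx> - (V + 4 * X)" by simp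
    have "of_nat 3 * triple_sum 2 2 2 \<approx> of_nat 3 * 0"
      using triple_sum_cyclic[of 2 2 2] assms(1) by simp
    then have 2: "triple_sum 2 2 2 \<approx> 0" by (rule cancel) auto
    show ?thesis by (rule zcong_combine[OF 1 2, of 1 "- 4"]) auto
  qed
  have f312: "6 * triple_sum 3 1 2 \<approx> - 3 * T - 4 * X"
  proof -
    have "{4..<5} = {4::nat}" by auto
    then have "bernoulli_tail 3 1 6 = 0" by (simp add: bernoulli_tail_def odd0)
    then have 1: "3 * triple_sum 3 1 2 \<approx> - bernoulli_conv 3 1 (p - 5)"
      using main[of 3 1 2] by simp
    have "2 * bernoulli_conv 3 1 (p - 5) + V = of_nat (p - 2) * C"
      using bernoulli_conv_euler[of 2 1 "p - 5"] assms(1) by (simp add: C_def V_def numeral_2_eq_2 [symmetric])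
    also have "\<dots> \<approx> - of_nat 2 * C" using int by (intro minus) auto
    finally have 2: "2 * bernoulli_conv 3 1 (p - 5) + V \<approx> - of_nat 2 * C" .
    have "6 * triple_sum 3 1 2 \<approx> V + 2 * C"
      by (rule zcong_combine[OF 1 2, of 2 "- 1"]) auto
    from zcong_trans[OF this zcong_add[OF V C]] show ?thesis
      by (rule zcong_rearrange) simp
  qed
  have f321: "6 * triple_sum 3 2 1 \<approx> - X"
  proof -
    have 1: "6 * triple_sum 3 2 1 \<approx> - bernoulli_conv 3 2 (p - 5)"
      using main[of 3 2 1] by (simp add: bernoulli_tail_def)
    have "4 * bernoulli_conv 3 2 (p - 5) = of_nat (p - 1) * V"
      using bernoulli_conv_diagonal[of 2 "p - 5"] assms(1) by (simp add: V_def)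
    also have "\<dots> \<approx> - of_nat 1 * V" using int by (intro minus) auto
    finally have 2: "4 * bernoulli_conv 3 2 (p - 5) \<approx> - of_nat 1 * V" .
    have "4 * (6 * triple_sum 3 2 1) \<approx> V"
      by (rule zcong_combine[OF 1 2, of 4 "- 1"]) auto
    also note V
    finally have "of_nat 4 * (6 * triple_sum 3 2 1) \<approx> of_nat 4 * (- X)" by simp
    then show ?thesis by (rule cancel) auto
  qed
  have TX: "3 * T \<approx> - 2 * X"
  proof -
    \<comment> \<open>In the combination \<open>3, 2, 2\<close> of the expansions the three sums become the cyclic one.\<close>
    have cyc: "triple_sum 2 1 3 + triple_sum 3 1 2 + triple_sum 3 2 1 \<approx> 0"
    proof -
      have "triple_sum 2 1 3 + triple_sum 2 3 1 + triple_sum 1 3 2 \<approx> 0"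
        by (rule triple_sum_cyclic) (use assms(1) in auto)
      then show ?thesis
        unfolding triple_sum_commute[of 2 3] triple_sum_commute[of 1 3]
        by (rule zcong_rearrange) simp
    qed
    have "3 * (4 * triple_sum 2 1 3) + 2 * (6 * triple_sum 3 1 2)
        \<approx> 3 * (3 * T + 4 * X) + 2 * (- 3 * T - 4 * X)"
      by (rule zcong_combine[OF f213 f312, of 3 2]) auto
    then have "12 * (triple_sum 2 1 3 + triple_sum 3 1 2 + triple_sum 3 2 1)
        \<approx> 3 * (3 * T + 4 * X) + 2 * (- 3 * T - 4 * X) - 2 * X"
      by (rule zcong_combine[OF _ f321, of _ _ 1 2]) auto
    then show ?thesis
      by (rule zcong_combine[OF _ cyc, of _ _ "- 1" 12]) auto
  qed
  have "of_nat 2 * (2 * triple_sum 2 1 3) \<approx> of_nat 2 * X"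
    by (rule zcong_combine[OF f213 TX, of 1 1]) auto
  then show "2 * triple_sum 2 1 3 \<approx> X" by (rule cancel) auto
  have "of_nat 2 * (- 3 * triple_sum 3 1 2) \<approx> of_nat 2 * X"
    by (rule zcong_combine[OF f312 TX, of "- 1" 1]) auto
  then show "- 3 * triple_sum 3 1 2 \<approx> X" by (rule cancel) auto
  show "- 6 * triple_sum 3 2 1 \<approx> X"
    using zcong_uminus[OF f321] by simp
  show f114: "- 3 * triple_sum 1 1 4 \<approx> X"
    by (rule zcong_combine[OF T TX, of "- 3" 1]) auto
  have cyc: "triple_sum 1 1 4 + 2 * triple_sum 4 1 1 \<approx> 0"
  proof -
    have "triple_sum 1 1 4 + triple_sum 1 4 1 + triple_sum 1 4 1 \<approx> 0"
      by (rule triple_sum_cyclic) (use assms(1) in auto)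
    then show ?thesis
      unfolding triple_sum_commute[of 1 4] by (rule zcong_rearrange) simp
  qed
  show "6 * triple_sum 4 1 1 \<approx> X"
    by (rule zcong_combine[OF f114 cyc, of 1 3]) auto
qed

text \<open>
  Both the convolution and the tail for \<open>(5, 4)\<close> are \<open>- 3/8\<close> times those for \<open>(4, 4)\<close>. For the
  convolution the factor is \<open>(n + 8)/8\<close> with \<open>n = p - 11\<close>. For the tail, the
  weight of \<open>B\<^bsub>p-7\<^esub>\<close> gains the factor \<open>(p - 3)/4\<close>, while \<open>Z\<close> occurs once instead of twice.
\<close>

lemma triple_sum_zcong_weight_12:
  assumes "17 \<le> p"
  shows "triple_sum 5 4 3 \<approx> 0"
proof -
  define V where "V = bernoulli_conv 4 4 (p - 11)"
  define Z where "Z = negbinom 4 (p - 7) * bernoulli (p - 7) * (negbinom 4 (p - 5) * bernoulli (p - 5))"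
  have int: "V \<in> p_integral" "Z \<in> p_integral"
    unfolding V_def Z_def
    by (intro p_integral_bernoulli_conv p_integral_mult p_integral_bernoulli p_integral_negbinom;
        use assms in simp)+
  have odd0: "bernoulli (p - 6) = 0"
    using assms by (auto intro!: bernoulli_p_minus_even)
  have cancel: "x \<approx> y" if "of_nat k * x \<approx> of_nat k * y" "0 < k" "k \<le> 16" for x y k
    using that(1) by (rule zcong_cancel) (rule not_p_dvd_less, use that assms in auto)
  have main: "of_nat (a * b) * triple_sum a b c
      \<approx> - (bernoulli_conv a b (p - 11) + bernoulli_tail a b 12)"
    if "0 < a" "0 < b" "0 < c" "a + b + c = 12" for a b c
    using triple_sum_zcong_bernoulli[of a b c 12] that assms by simp
  have f444: "16 * triple_sum 4 4 4 \<approx> - (V + 2 * Z)"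
  proof -
    have "{5..<8} = {5, 6, 7::nat}" by auto
    then have "bernoulli_tail 4 4 12 = 2 * Z"
      by (simp add: bernoulli_tail_def odd0 Z_def)
    then show ?thesis using main[of 4 4 4] by (simp add: V_def)
  qed
  have conv: "8 * bernoulli_conv 5 4 (p - 11) \<approx> - 3 * V"
  proof -
    have "8 * bernoulli_conv 5 4 (p - 11) = of_nat (p - 3) * V"
      using bernoulli_conv_diagonal[of 4 "p - 11"] assms by (simp add: V_def)
    also have "\<dots> \<approx> - of_nat 3 * V" using int assms by (intro zcong_p_minus_mult) auto
    finally show ?thesis by simp
  qed
  have tail: "4 * bernoulli_tail 5 4 12 \<approx> - 3 * Z"
  proof -
    have "{6..<8} = {6, 7::nat}" by auto
    then have "4 * bernoulli_tail 5 4 12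
        = 4 * negbinom 5 (p - 7) * bernoulli (p - 7) * (negbinom 4 (p - 5) * bernoulli (p - 5))"
      by (simp add: bernoulli_tail_def odd0)
    also have "\<dots> = of_nat (p - 3) * Z"
      using negbinom_Suc[of 4 "p - 7"] assms by (simp add: Z_def)
    also have "\<dots> \<approx> - of_nat 3 * Z" using int assms by (intro zcong_p_minus_mult) auto
    finally show ?thesis by simp
  qed
  have f543: "20 * triple_sum 5 4 3 \<approx> - (bernoulli_conv 5 4 (p - 11) + bernoulli_tail 5 4 12)"
    using main[of 5 4 3] by simp
  have "of_nat 3 * triple_sum 4 4 4 \<approx> of_nat 3 * 0"
    using triple_sum_cyclic[of 4 4 4] assms by simp
  then have zero: "triple_sum 4 4 4 \<approx> 0" by (rule cancel) auto
  have "8 * (bernoulli_conv 5 4 (p - 11) + bernoulli_tail 5 4 12) \<approx> - 3 * (V + 2 * Z)"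
    by (rule zcong_combine[OF conv tail, of 1 2]) auto
  then have "160 * triple_sum 5 4 3 \<approx> 3 * (V + 2 * Z)"
    by (rule zcong_combine[OF f543, of _ _ 8 "- 1"]) auto
  then have "160 * triple_sum 5 4 3 \<approx> - 48 * triple_sum 4 4 4"
    by (rule zcong_combine[OF _ f444, of _ _ 1 3]) auto
  \<comment> \<open>\<open>160\<close> is cancelled in two factors below \<open>p\<close>, which are therefore prime to \<open>p\<close>.\<close>
  then have "of_nat 10 * (of_nat 16 * triple_sum 5 4 3) \<approx> of_nat 10 * (of_nat 16 * 0)"
    by (rule zcong_combine[OF _ zero, of _ _ 1 "- 48"]) auto
  then have "of_nat 16 * triple_sum 5 4 3 \<approx> of_nat 16 * 0"
    by (rule cancel) auto
  then show ?thesis by (rule cancel) auto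
qed

end

theorem theorem2p3:
  shows "(\<forall>p::nat. prime p \<and> 11 \<le> p \<longrightarrow>
      [2 * (\<Sum>j = 1..p-1. harmonic 2 j * harmonic 1 j / of_nat j ^ 3)
        \<equiv> - 3 * (\<Sum>j = 1..p-1. harmonic 3 j * harmonic 1 j / of_nat j ^ 2)] (rmod p) \<and>
      [- 3 * (\<Sum>j = 1..p-1. harmonic 3 j * harmonic 1 j / of_nat j ^ 2)
        \<equiv> - 6 * (\<Sum>j = 1..p-1. harmonic 3 j * harmonic 2 j / of_nat j)] (rmod p) \<and>
      [- 6 * (\<Sum>j = 1..p-1. harmonic 3 j * harmonic 2 j / of_nat j)
        \<equiv> - 3 * (\<Sum>j = 1..p-1. (harmonic 1 j)^2 / of_nat j ^ 4)] (rmod p) \<and>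
      [- 3 * (\<Sum>j = 1..p-1. (harmonic 1 j)^2 / of_nat j ^ 4)
        \<equiv> 6 * (\<Sum>j = 1..p-1. harmonic 4 j * harmonic 1 j / of_nat j)] (rmod p) \<and>
      [6 * (\<Sum>j = 1..p-1. harmonic 4 j * harmonic 1 j / of_nat j)
        \<equiv> (bernoulli (p - 3))^2] (rmod p) \<and>
      [(\<Sum>j = 1..p-1. harmonic 1 j * harmonic 2 j / of_nat j ^ 2)
        \<equiv> - (1/2) * bernoulli (p - 5)] (rmod p))
    \<and> (\<forall>p::nat. prime p \<and> 17 \<le> p \<longrightarrow>
      [(\<Sum>j = 1..p-1. harmonic 5 j * harmonic 4 j / of_nat j ^ 3) \<equiv> 0] (rmod p))"
proof (intro conjI allI impI; elim conjE)
  fix p :: nat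
  assume p: "prime p" "11 \<le> p"
  then interpret odd_prime p by unfold_locales auto
  have sums: "(\<Sum>j = 1..p-1. harmonic a j * harmonic b j / of_nat j ^ c) = triple_sum a b c"
    "(\<Sum>j = 1..p-1. harmonic a j * harmonic b j / of_nat j) = triple_sum a b 1"
    "(\<Sum>j = 1..p-1. (harmonic a j)^2 / of_nat j ^ c) = triple_sum a a c" for a b c
    by (simp_all add: triple_sum_def power2_eq_square)
  note w6 = triple_sums_zcong_weight_6[OF p(2)]
  note cong = zcong_imp_rat_cong[OF zcong_trans[OF _ zcong_sym]]
  have int: "bernoulli (p - 3) \<in> p_integral" "bernoulli (p - 5) \<in> p_integral"
    using p by (auto intro!: p_integral_bernoulli)
  have "1 / of_nat 2 \<in> p_integral"
    by (rule p_integral_inverse, rule not_p_dvd_less) (use p in auto)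
  then have half: "- (1/2) * bernoulli (p - 5) \<in> p_integral"
    using int by (intro p_integral_mult p_integral_uminus) simp_all
  show "[2 * (\<Sum>j = 1..p-1. harmonic 2 j * harmonic 1 j / of_nat j ^ 3)
        \<equiv> - 3 * (\<Sum>j = 1..p-1. harmonic 3 j * harmonic 1 j / of_nat j ^ 2)] (rmod p)"
    unfolding sums by (rule cong[OF w6(1) w6(2)]) auto
  show "[- 3 * (\<Sum>j = 1..p-1. harmonic 3 j * harmonic 1 j / of_nat j ^ 2)
        \<equiv> - 6 * (\<Sum>j = 1..p-1. harmonic 3 j * harmonic 2 j / of_nat j)] (rmod p)"
    unfolding sums by (rule cong[OF w6(2) w6(3)]) auto
  show "[- 6 * (\<Sum>j = 1..p-1. harmonic 3 j * harmonic 2 j / of_nat j)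
        \<equiv> - 3 * (\<Sum>j = 1..p-1. (harmonic 1 j)^2 / of_nat j ^ 4)] (rmod p)"
    unfolding sums by (rule cong[OF w6(3) w6(4)]) auto
  show "[- 3 * (\<Sum>j = 1..p-1. (harmonic 1 j)^2 / of_nat j ^ 4)
        \<equiv> 6 * (\<Sum>j = 1..p-1. harmonic 4 j * harmonic 1 j / of_nat j)] (rmod p)"
    unfolding sums by (rule cong[OF w6(4) w6(5)]) auto
  show "[6 * (\<Sum>j = 1..p-1. harmonic 4 j * harmonic 1 j / of_nat j)
        \<equiv> (bernoulli (p - 3))^2] (rmod p)"
    unfolding sums by (rule zcong_imp_rat_cong[OF w6(5)]) (use int in auto)
  show "[(\<Sum>j = 1..p-1. harmonic 1 j * harmonic 2 j / of_nat j ^ 2)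
        \<equiv> - (1/2) * bernoulli (p - 5)] (rmod p)"
    unfolding sums by (rule zcong_imp_rat_cong[OF triple_sum_zcong_weight_5[OF p(2)] _ half]) auto
next
  fix p :: nat
  assume p: "prime p" "17 \<le> p"
  then interpret odd_prime p by unfold_locales auto
  show "[(\<Sum>j = 1..p-1. harmonic 5 j * harmonic 4 j / of_nat j ^ 3) \<equiv> 0] (rmod p)"
    unfolding triple_sum_def[symmetric]
    by (rule zcong_imp_rat_cong[OF triple_sum_zcong_weight_12[OF p(2)]]) auto
qed

end
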